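(* Let $\lambda\in\mathbb N$, let $(X,d)$ be a $\lambda$-doubling compact metric space, and let $\mu$ be a Borel probability measure on $X$. Then for every positive integer $t$ there exists a closed subset $U\subseteq X$ satisfying: \begin{itemize} \item The ultrametric distortion of $U$ (with the metric $d|_U$) is at most $8t$. \item There exists a Borel probability measure $\nu$ supported on $U$ satisfying \[ \nu\left(B_d(x,r)\right)\le \lambda^{2/t} \left(\mu(B_d(x,(16t+1)r))\right)^{1-1/t} \] for all $x\in X$ and $r\in [0,\infty)$. \end{itemize}
   Context: A metric space $(X,d)$ is called $\lambda$-doubling if any bounded subset $Z\subseteq X$ can be covered by at most $\lambda$ subsets of diameter at most $\operatorname{diam}_d(Z)/2$. An ultrametric on a set is a metric $\rho$ satisfying $\rho(x,y)\le \max\{\rho(x,z),\rho(y,z)\}$ for all points $x,y,z$. A metric space $(Y,d)$ embeds with distortion $D\in[1,\infty)$ into an ultrametric space if there exists an ultrametric $\rho$ on $Y$ satisfying $d(x,y)\le\rho(x,y)\le D\,d(x,y)$ for all $x,y\in Y$. The ultrametric distortion of $Y$ is the infimum over $D$ for which $Y$ embeds in an ultrametric space with distortion at most $D$. $B_d(x,r)=\{y\in X: d(y,x)\le r\}$ denotes the closed ball. When $t=1$, the exponent $1-1/t=0$ and $s^0=1$ for all $s\ge 0$ (including $s=0$). *)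

theory Defs
  imports "HOL-Analysis.Analysis" "HOL-Probability.Probability_Measure"
begin

text \<open>A metric space is given as a set in a type of class \<open>metric_space\<close>, with the
  induced metric \<^const>\<open>dist\<close>.\<close>

text \<open>The requirement \<open>bounded W\<close> is needed because \<^const>\<open>diameter\<close> is a
  supremum in the reals, hence unspecified on unbounded sets.\<close>

definition doubling_space :: "nat \<Rightarrow> 'a::metric_space set \<Rightarrow> bool" where
  "doubling_space l X \<longleftrightarrow>
     (\<forall>Z. Z \<subseteq> X \<and> bounded Z \<longrightarrow>
        (\<exists>F. finite F \<and> card F \<le> l \<and> Z \<subseteq> \<Union>F \<and>
             (\<forall>W\<in>F. W \<subseteq> X \<and> bounded W \<and> diameter W \<le> diameter Z / 2)))"

definition ultrametric_on :: "'a set \<Rightarrow> ('a \<Rightarrow> 'a \<Rightarrow> real) \<Rightarrow> bool" where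
  "ultrametric_on Y \<rho> \<longleftrightarrow> Metric_space Y \<rho> \<and>
     (\<forall>x\<in>Y. \<forall>y\<in>Y. \<forall>z\<in>Y. \<rho> x y \<le> max (\<rho> x z) (\<rho> y z))"

definition embeds_in_ultrametric :: "'a::metric_space set \<Rightarrow> real \<Rightarrow> bool" where
  "embeds_in_ultrametric Y D \<longleftrightarrow>
     (\<exists>\<rho>. ultrametric_on Y \<rho> \<and>
          (\<forall>x\<in>Y. \<forall>y\<in>Y. dist x y \<le> \<rho> x y \<and> \<rho> x y \<le> D * dist x y))"

text \<open>Extended-real valued, so that the distortion is \<open>\<infinity>\<close> (the infimum of the
  empty set) when there is no embedding of finite distortion.\<close>

definition ultrametric_distortion :: "'a::metric_space set \<Rightarrow> ereal" where
  "ultrametric_distortion Y = Inf {ereal D | D. 1 \<le> D \<and> embeds_in_ultrametric Y D}"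

definition borel_prob_on :: "'a::metric_space set \<Rightarrow> 'a measure \<Rightarrow> bool" where
  "borel_prob_on X \<mu> \<longleftrightarrow> prob_space \<mu> \<and> sets \<mu> = sets (restrict_space borel X)"

text \<open>For a closed set \<open>U\<close> in a compact (hence second countable) space this says that the
  topological support of the measure is contained in \<open>U\<close>.\<close>

definition supported_on :: "'a measure \<Rightarrow> 'a set \<Rightarrow> bool" where
  "supported_on \<nu> U \<longleftrightarrow> emeasure \<nu> (space \<nu> - U) = 0"

text \<open>Real powers of nonnegative bases with \<open>0\<close> to the power \<open>0\<close> equal to \<open>1\<close>, whereas
  \<open>0 powr 0 = 0\<close>.\<close>

definition rpow :: "real \<Rightarrow> real \<Rightarrow> real" where
  "rpow s a = (if a = 0 then 1 else s powr a)"

end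

theory Submission
  imports Defs
begin

text \<open>The skeleton is the limit of a hierarchy of clusters obtained by ball carving, and the measure is
  the limit of a mass distribution on that hierarchy.

  Let \<open>r\<^sub>n = R / 2\<^sup>n\<close>, where \<open>R\<close> bounds the distances in \<open>X\<close>. For a Borel set
  \<open>Z\<close> write \<open>peak r Z\<close> for the largest mass \<open>\<mu>(B(x, r) \<inter> Z)\<close> over \<open>x \<in> X\<close>; it is attained because
  \<open>X\<close> is compact and this mass is upper semicontinuous in \<open>x\<close>. Everything is governed by the
  potential \<open>\<mu>(Z) / (peak r Z)\<^sup>1\<^sup>/\<^sup>t\<close>. A cluster \<open>Z\<close> of scale \<open>r\<close> is split by taking a centre
  that maximizes the mass of the ball of radius \<open>r/2\<close>, and letting the radius grow from
  \<open>r/2\<close> to \<open>r\<close> in \<open>t\<close> equal steps. In one of the steps the mass grows by at most the \<open>t\<close>-th root of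
  the total growth. The ball before this step is a new cluster of scale \<open>r/2\<close>, the shell added by the
  step is thrown away, and the rest of \<open>Z\<close> is carved in the same manner. The choice of the step says exactly that
  the potential of the new cluster pays for the mass of the cluster and the shell together. Hence the
  potentials of the new clusters add up to at least that of \<open>Z\<close> (\<open>split_cluster\<close>), while the
  shells keep them \<open>r/(2t)\<close> apart.

  Consequently a cluster of scale \<open>r\<^sub>n\<close> has diameter at most \<open>4r\<^sub>n\<close> and different clusters of this scale
  are at least \<open>r\<^sub>n/t\<close> apart. Points that are separated for the first time at scale \<open>r\<^sub>n\<^sub>+\<^sub>1\<close>
  have a distance between \<open>r\<^sub>n/(2t)\<close> and \<open>4r\<^sub>n\<close>, and the quotient of the two bounds is the
  distortion \<open>8t\<close> (\<open>embeds_in_ultrametric_of_hierarchy\<close>).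

  As the potential does not decrease under splitting, the unit interval can be divided along the
  hierarchy so that each cluster receives an interval no longer than its potential
  (\<open>cluster_level_refine\<close>). A point of the unit interval determines a nested sequence of
  clusters, and the closures of these shrink to a point of \<open>X\<close>; \<open>\<nu>\<close> is the image of Lebesgue
  measure under this map, and \<open>U\<close> is the closure of its range. By two applications of the
  doubling property with constant \<open>l\<close>, a cluster \<open>C\<close> of scale \<open>r\<close> is covered by \<open>l\<^sup>2\<close> balls of radius \<open>r\<close>, so
  \<open>peak r C \<ge> \<mu>(C) / l\<^sup>2\<close> and the potential is at most \<open>l\<^sup>2\<^sup>/\<^sup>t \<mu>(C)\<^sup>1\<^sup>-\<^sup>1\<^sup>/\<^sup>t\<close>
  (\<open>potential_le_doubling\<close>). A ball \<open>B(x, r)\<close> with \<open>r > 0\<close> meets \<open>U\<close> in at most one cluster of the smallest scale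
  \<open>r\<^sub>k\<close> with \<open>r\<^sub>k/t > 2r\<close>. For this scale \<open>4r\<^sub>k \<le> 16tr\<close>, hence the cluster lies in
  \<open>B(x, (16t+1)r)\<close>. If no scale qualifies, the larger ball is all of \<open>X\<close>, and the case \<open>r = 0\<close>
  follows by letting \<open>r\<close> decrease to \<open>0\<close>.\<close>

section \<open>Elementary facts\<close>

text \<open>If every one of the \<open>t\<close> steps multiplied \<open>b\<close> by more than the \<open>t\<close>-th root of the total growth
  \<open>b t / b 0\<close>, the product of the steps would exceed \<open>b t / b 0\<close>. The inequality is stated in the
  normalization in which it compares potentials.\<close>

lemma exists_small_relative_growth:
  fixes b :: "nat \<Rightarrow> real"
  assumes t: "t \<ge> 1" and b0: "b 0 > 0" and bt: "b t > 0"
  shows "\<exists>i<t. b (Suc i) / b t powr (1 / real t) \<le> b i / b 0 powr (1 / real t)"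
proof (rule ccontr)
  define q where "q = (b t / b 0) powr (1 / real t)"
  have q: "q > 0" "q ^ t = b t / b 0"
    using b0 bt t by (auto simp: q_def powr_realpow[symmetric] powr_powr)
  assume "\<not> ?thesis"
  then have step: "b i * q < b (Suc i)" if "i < t" for i
    using that b0 bt by (force simp: q_def powr_divide field_simps not_le)
  have weak: "b 0 * q ^ i \<le> b i" if "i \<le> t" for i
    using that
  proof (induction i)
    case (Suc i)
    then have "b 0 * q ^ i * q \<le> b i * q" using q by (intro mult_right_mono) auto
    then show ?case using step[of i] Suc.prems by (simp add: mult.assoc mult.left_commute mult.commute)
  qed simp
  obtain k where k: "t = Suc k" using t by (cases t) auto
  have "b 0 * q ^ k * q \<le> b k * q" using weak[of k] k q by (intro mult_right_mono) auto
  then have "b 0 * q ^ t < b t" using step[of k] k by (simp add: mult_ac)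
  then show False using q b0 by simp
qed

text \<open>This is how mass is passed from a cluster, represented by \<open>[a, b)\<close>, to its children \<open>J\<close>: cut off
  consecutive pieces of lengths \<open>w j\<close>, truncated at \<open>b\<close>, until the interval is used up.\<close>

lemma interval_allocation:
  fixes w :: "'b \<Rightarrow> real"
  assumes "finite J" and "\<And>j. j \<in> J \<Longrightarrow> 0 \<le> w j" and "a \<le> b" and "b - a \<le> sum w J"
  shows "\<exists>h. (\<forall>s\<in>{a..<b}. h s \<in> J) \<and>
           (\<forall>j\<in>J. \<exists>c d. c \<le> d \<and> {s\<in>{a..<b}. h s = j} = {c..<d} \<and> d - c \<le> w j)"
  using assms
proof (induction J arbitrary: a rule: finite_induct)
  case empty
  then show ?case by auto
next
  case (insert j J)
  define c where "c = min b (a + w j)"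
  have c: "a \<le> c" "c \<le> b" "c - a \<le> w j" using insert.prems by (auto simp: c_def min_def)
  have "0 \<le> sum w J" using insert.prems by (intro sum_nonneg) auto
  then have "b - c \<le> sum w J" using insert by (auto simp: c_def min_def)
  then obtain h where h: "\<forall>s\<in>{c..<b}. h s \<in> J"
    "\<forall>j\<in>J. \<exists>c' d. c' \<le> d \<and> {s\<in>{c..<b}. h s = j} = {c'..<d} \<and> d - c' \<le> w j"
    using insert.IH[of c] insert.prems c by auto
  define h' where "h' s = (if s < c then j else h s)" for s
  have "{s\<in>{a..<b}. h' s = j} = {a..<c}" using h(1) c insert.hyps by (force simp: h'_def)
  moreover have "{s\<in>{a..<b}. h' s = j'} = {s\<in>{c..<b}. h s = j'}" if "j' \<in> J" for j'
    using that c insert.hyps by (auto simp: h'_def)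
  moreover have "\<forall>s\<in>{a..<b}. h' s \<in> insert j J" using h(1) by (auto simp: h'_def)
  ultimately show ?case using h(2) c by (intro exI[of _ h']) auto
qed

lemma powr_le_rpow: "s powr a \<le> rpow s a"
  by (simp add: rpow_def)

lemma dist_closure_ge:
  assumes "\<And>x y. x \<in> A \<Longrightarrow> y \<in> B \<Longrightarrow> d \<le> dist x y" and "x \<in> closure A" "y \<in> closure B"
  shows "d \<le> dist x y"
proof -
  have "closed {p :: 'a \<times> 'a. d \<le> dist (fst p) (snd p)}"
    by (intro closed_Collect_le continuous_intros)
  then have "closure (A \<times> B) \<subseteq> {p. d \<le> dist (fst p) (snd p)}"
    using assms(1) by (intro closure_minimal) auto
  then show ?thesis using assms(2,3) by (auto simp: closure_Times)
qed

lemma dist_closure_le: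
  assumes "\<And>x y. x \<in> A \<Longrightarrow> y \<in> B \<Longrightarrow> dist x y \<le> d" and "x \<in> closure A" "y \<in> closure B"
  shows "dist x y \<le> d"
proof -
  have "closed {p :: 'a \<times> 'a. dist (fst p) (snd p) \<le> d}"
    by (intro closed_Collect_le continuous_intros)
  then have "closure (A \<times> B) \<subseteq> {p. dist (fst p) (snd p) \<le> d}"
    using assms(1) by (intro closure_minimal) auto
  then show ?thesis using assms(2,3) by (auto simp: closure_Times)
qed

section \<open>Ultrametrics from nested partitions\<close>

text \<open>Distinct points are eventually separated by the equivalence relations \<open>E n\<close>. Their new distance is
  \<open>a m\<close>, where \<open>m\<close> is the last level at which they are still equivalent; transitivity of the
  relations is the ultrametric inequality. The distortion bound holds because the points are separated at the
  next level, so that their old distance is at least \<open>b (Suc m)\<close>.\<close>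

lemma embeds_in_ultrametric_of_hierarchy:
  fixes U :: "'a::metric_space set" and E :: "nat \<Rightarrow> 'a \<Rightarrow> 'a \<Rightarrow> bool" and a b :: "nat \<Rightarrow> real"
  assumes sym: "\<And>n x y. E n x y \<Longrightarrow> E n y x"
    and trans: "\<And>n x y z. x \<in> U \<Longrightarrow> y \<in> U \<Longrightarrow> z \<in> U \<Longrightarrow> E n x z \<Longrightarrow> E n z y \<Longrightarrow> E n x y"
    and total: "\<And>x y. x \<in> U \<Longrightarrow> y \<in> U \<Longrightarrow> E 0 x y"
    and nested: "\<And>n x y. E (Suc n) x y \<Longrightarrow> E n x y"
    and close: "\<And>n x y. E n x y \<Longrightarrow> dist x y \<le> a n"
    and far: "\<And>n x y. x \<in> U \<Longrightarrow> y \<in> U \<Longrightarrow> \<not> E n x y \<Longrightarrow> b n \<le> dist x y"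
    and a: "decseq a" "a \<longlonglongrightarrow> 0" "\<And>n. a n > 0"
    and ab: "\<And>n. a n \<le> D * b (Suc n)" and D: "D \<ge> 0"
  shows "embeds_in_ultrametric U D"
proof -
  \<comment> \<open>\<open>L x y\<close> is the first level that separates the points; it is positive on \<open>U\<close>.\<close>
  define L where "L x y = (LEAST n. \<not> E n x y)" for x y
  define \<rho> where "\<rho> x y = (if x = y then 0 else a (L x y - 1))" for x y
  have nested': "E m x y" if "m \<le> n" "E n x y" for m n x y
    using that by (induction rule: inc_induct) (auto intro: nested)
  have sep: "\<exists>n. \<not> E n x y" if "x \<noteq> y" for x y
  proof (rule ccontr)
    assume "\<not> ?thesis"
    then have "\<And>n. dist x y \<le> a n" using close by blast
    then have "dist x y \<le> 0" using a(2) by (intro LIMSEQ_le_const) auto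
    then show False using that by simp
  qed
  have L: "E n x y \<longleftrightarrow> n < L x y" if "x \<noteq> y" for n x y
  proof
    show "E n x y" if "n < L x y" using that not_less_Least unfolding L_def by blast
    have "\<not> E (L x y) x y" unfolding L_def using sep[OF \<open>x \<noteq> y\<close>] by (rule LeastI_ex)
    then show "n < L x y" if "E n x y" using that nested' not_le_imp_less by blast
  qed
  have Lpos: "0 < L x y" if "x \<noteq> y" "x \<in> U" "y \<in> U" for x y
    using L total that by blast
  have Lsym: "L x y = L y x" for x y
    unfolding L_def using sym by (metis (no_types))
  have pos: "0 \<le> \<rho> x y" for x y using a(3) by (auto simp: \<rho>_def less_imp_le)
  have ultra: "\<rho> x y \<le> max (\<rho> x z) (\<rho> y z)" if U: "x \<in> U" "y \<in> U" "z \<in> U" for x y z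
  proof (cases "x = y \<or> x = z \<or> y = z")
    case True
    then show ?thesis using pos[of x z] Lsym[of x y] by (auto simp: \<rho>_def)
  next
    case False
    define m where "m = min (L x z) (L y z) - 1"
    have "m < L x z" "m < L z y" using Lpos[of x z] Lpos[of y z] Lsym[of y z] False U
      by (auto simp: m_def)
    then have "E m x y" using trans[of x y z m] L[of x z m] L[of z y m] U False by auto
    then have "m \<le> L x y - 1" using L[of x y m] False by simp
    then have "a (L x y - 1) \<le> a m" using a(1) by (simp add: decseqD)
    moreover have "a m \<le> max (a (L x z - 1)) (a (L y z - 1))"
      by (cases "L x z \<le> L y z") (auto simp: m_def min_def)
    ultimately show ?thesis using False by (auto simp: \<rho>_def)
  qed
  have "Metric_space U \<rho>"
  proof
    fix x y z
    show "0 \<le> \<rho> x y" by (rule pos)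
    show "\<rho> x y = \<rho> y x" by (simp add: \<rho>_def Lsym)
    show "(\<rho> x y = 0) = (x = y)" using a(3)[of "L x y - 1"] by (auto simp: \<rho>_def)
    assume "x \<in> U" "y \<in> U" "z \<in> U"
    from ultra[OF this(1,3,2)] show "\<rho> x z \<le> \<rho> x y + \<rho> y z"
      using pos[of x y] pos[of y z] Lsym[of y z] by (auto simp: \<rho>_def)
  qed
  moreover have "dist x y \<le> \<rho> x y \<and> \<rho> x y \<le> D * dist x y" if "x \<in> U" "y \<in> U" for x y
  proof (cases "x = y")
    case False
    define m where "m = L x y - 1"
    have m: "L x y = Suc m" using Lpos[of x y] False that by (simp add: m_def)
    then have "E m x y" "\<not> E (Suc m) x y" using L[OF False] by auto
    then have "dist x y \<le> a m" "b (Suc m) \<le> dist x y" using close far that by auto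
    moreover have "a m \<le> D * dist x y"
      using ab[of m] mult_left_mono[OF \<open>b (Suc m) \<le> dist x y\<close> D] by linarith
    ultimately show ?thesis using False by (simp add: \<rho>_def m)
  qed (auto simp: \<rho>_def)
  ultimately show ?thesis
    using ultra unfolding embeds_in_ultrametric_def ultrametric_on_def by blast
qed

section \<open>Mass of balls in a compact probability space\<close>

locale compact_prob_space =
  fixes X :: "'a::metric_space set" and \<mu> :: "'a measure"
  assumes compact: "compact X" and borel_prob: "borel_prob_on X \<mu>"
begin

sublocale prob_space \<mu>
  using borel_prob unfolding borel_prob_on_def by blast

lemma sets_iff: "A \<in> sets \<mu> \<longleftrightarrow> A \<in> sets borel \<and> A \<subseteq> X"
  using borel_prob compact_imp_closed[OF compact]
  by (auto simp: borel_prob_on_def sets_restrict_space_iff)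

lemma space_eq: "space \<mu> = X"
  using borel_prob sets_eq_imp_space_eq[of \<mu> "restrict_space borel X"]
  by (auto simp: borel_prob_on_def space_restrict_space)

lemma X_nonempty: "X \<noteq> {}"
  using not_empty space_eq by simp

lemma sets_cball_Int: "Z \<in> sets \<mu> \<Longrightarrow> cball x r \<inter> Z \<in> sets \<mu>"
  by (auto simp: sets_iff)

text \<open>Closed balls depend on the radius continuously from the right, which serves both for the upper
  semicontinuity behind \<open>peak_attained\<close> and for the passage to radius \<open>0\<close>.\<close>

lemma tendsto_prob_cball:
  assumes Z: "Z \<in> sets \<mu>" and c: "c > 0"
  shows "(\<lambda>n. prob (cball x (r + c / real (Suc n)) \<inter> Z)) \<longlonglongrightarrow> prob (cball x r \<inter> Z)"
proof -
  let ?B = "\<lambda>n. cball x (r + c / real (Suc n)) \<inter> Z"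
  have "c / real (Suc m) \<le> c / real (Suc n)" if "n \<le> m" for m n
    using that c by (intro divide_left_mono) auto
  then have "decseq ?B" by (auto simp: decseq_def) fastforce
  moreover have "range ?B \<subseteq> sets \<mu>" using sets_cball_Int[OF Z] by auto
  moreover have "(\<Inter>n. ?B n) = cball x r \<inter> Z"
  proof (intro equalityI subsetI)
    fix y assume y: "y \<in> (\<Inter>n. ?B n)"
    have "(\<lambda>n. r + c * inverse (real (Suc n))) \<longlonglongrightarrow> r + c * 0"
      by (intro tendsto_intros LIMSEQ_inverse_real_of_nat)
    then have "(\<lambda>n. r + c / real (Suc n)) \<longlonglongrightarrow> r" by (simp add: divide_inverse)
    then have "dist x y \<le> r" using y by (intro LIMSEQ_le_const) auto
    then show "y \<in> cball x r \<inter> Z" using y by auto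
  next
    fix y assume "y \<in> cball x r \<inter> Z"
    then show "y \<in> (\<Inter>n. ?B n)" using c by (auto intro: order_trans)
  qed
  ultimately show ?thesis using finite_Lim_measure_decseq[of ?B] by simp
qed

definition peak :: "real \<Rightarrow> 'a set \<Rightarrow> real" where
  "peak r Z = (SUP x\<in>X. prob (cball x r \<inter> Z))"

lemma prob_le_peak: "x \<in> X \<Longrightarrow> prob (cball x r \<inter> Z) \<le> peak r Z"
  unfolding peak_def by (intro cSUP_upper bdd_aboveI[of _ 1]) auto

lemma peak_le: "(\<And>x. x \<in> X \<Longrightarrow> prob (cball x r \<inter> Z) \<le> M) \<Longrightarrow> peak r Z \<le> M"
  unfolding peak_def using X_nonempty by (intro cSUP_least) auto

lemma peak_nonneg: "0 \<le> peak r Z"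
  using X_nonempty prob_le_peak measure_nonneg order_trans by (metis ex_in_conv)

lemma peak_mono: "A \<subseteq> Z \<Longrightarrow> Z \<in> sets \<mu> \<Longrightarrow> peak r A \<le> peak r Z"
  by (rule peak_le) (rule order_trans[OF finite_measure_mono prob_le_peak], auto simp: sets_cball_Int)

text \<open>Let \<open>f n\<close> be nearly optimal centres that converge to \<open>x\<close>. Every ball of radius larger than \<open>r\<close> about
  \<open>x\<close> contains almost all balls of radius \<open>r\<close> about the \<open>f n\<close>; then shrink its radius to \<open>r\<close>. The limit
  \<open>x\<close> lies in \<open>X\<close> but possibly not in \<open>Z\<close>, which is why \<open>peak\<close> admits all centres in \<open>X\<close>.\<close>

lemma peak_attained:
  assumes Z: "Z \<in> sets \<mu>"
  obtains x where "x \<in> X" "prob (cball x r \<inter> Z) = peak r Z"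
proof -
  have "\<exists>x\<in>X. peak r Z - 1 / real (Suc n) < prob (cball x r \<inter> Z)" for n
    unfolding peak_def using X_nonempty
    by (subst less_cSUP_iff[symmetric]) (auto intro: bdd_aboveI[of _ 1])
  then obtain f where f: "\<And>n. f n \<in> X" "\<And>n. peak r Z - 1 / real (Suc n) < prob (cball (f n) r \<inter> Z)"
    by metis
  obtain x \<sigma> where x: "x \<in> X" "strict_mono \<sigma>" "(f \<circ> \<sigma>) \<longlonglongrightarrow> x"
    using compact f(1) unfolding compact_def by blast
  have *: "peak r Z \<le> prob (cball x (r + 1 / real (Suc m)) \<inter> Z)" for m
  proof -
    have "eventually (\<lambda>n. dist (f (\<sigma> n)) x < 1 / real (Suc m)) sequentially"
      using tendstoD[OF x(3)] by simp
    then have "eventually (\<lambda>n. peak r Z - 1 / real (Suc n) \<le> prob (cball x (r + 1 / real (Suc m)) \<inter> Z)) sequentially"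
    proof eventually_elim
      case (elim n)
      have "n \<le> \<sigma> n" using x(2) by (rule seq_suble)
      then have "1 / real (Suc (\<sigma> n)) \<le> 1 / real (Suc n)" by (intro divide_left_mono) auto
      moreover have "prob (cball (f (\<sigma> n)) r \<inter> Z) \<le> prob (cball x (r + 1 / real (Suc m)) \<inter> Z)"
      proof (rule finite_measure_mono)
        show "cball (f (\<sigma> n)) r \<inter> Z \<subseteq> cball x (r + 1 / real (Suc m)) \<inter> Z"
        proof
          fix y assume "y \<in> cball (f (\<sigma> n)) r \<inter> Z"
          then show "y \<in> cball x (r + 1 / real (Suc m)) \<inter> Z"
            using elim dist_triangle[of x y "f (\<sigma> n)"] by (auto simp: dist_commute)
        qed
      qed (rule sets_cball_Int[OF Z])
      ultimately show ?case using f(2)[of "\<sigma> n"] by linarith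
    qed
    moreover have "(\<lambda>n. peak r Z - 1 / real (Suc n)) \<longlonglongrightarrow> peak r Z - 0"
      by (intro tendsto_intros lim_1_over_n[THEN LIMSEQ_Suc])
    ultimately show ?thesis by (intro tendsto_upperbound[where f = "\<lambda>n. peak r Z - 1 / real (Suc n)"]) auto
  qed
  have "peak r Z \<le> prob (cball x r \<inter> Z)"
    using * by (intro LIMSEQ_le_const[OF tendsto_prob_cball[OF Z, of 1]]) auto
  with prob_le_peak[OF x(1)] that x(1) show ?thesis by (meson order_antisym)
qed

lemma prob_le_card_mult_peak:
  assumes N: "finite N" "N \<subseteq> X" and Z: "Z \<in> sets \<mu>" "Z \<subseteq> (\<Union>x\<in>N. cball x r)"
  shows "prob Z \<le> real (card N) * peak r Z"
proof -
  have "Z = (\<Union>x\<in>N. cball x r \<inter> Z)" using Z by auto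
  then have "prob Z \<le> (\<Sum>x\<in>N. prob (cball x r \<inter> Z))"
    using finite_measure_subadditive_finite[OF N(1), of "\<lambda>x. cball x r \<inter> Z"] sets_cball_Int[OF Z(1)]
    by auto
  also have "\<dots> \<le> (\<Sum>x\<in>N. peak r Z)" using N prob_le_peak by (intro sum_mono) auto
  finally show ?thesis by simp
qed

lemma finite_net:
  assumes "r > 0"
  obtains N where "finite N" "N \<subseteq> X" "X \<subseteq> (\<Union>x\<in>N. cball x r)"
proof -
  have "X \<subseteq> (\<Union>x\<in>X. ball x r)" using assms by auto
  then obtain N where N: "N \<subseteq> X" "finite N" "X \<subseteq> (\<Union>x\<in>N. ball x r)"
    by (rule compactE_image[OF compact open_ball])
  moreover have "ball x r \<subseteq> cball x r" for x by auto
  ultimately show ?thesis using N(3) by (intro that[OF N(2,1)]) blast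
qed

lemma peak_pos:
  assumes "Z \<in> sets \<mu>" "prob Z > 0" "r > 0"
  shows "peak r Z > 0"
proof -
  obtain N where N: "finite N" "N \<subseteq> X" "X \<subseteq> (\<Union>x\<in>N. cball x r)" using finite_net assms(3) .
  have "prob Z \<le> real (card N) * peak r Z"
    using N assms sets_iff by (intro prob_le_card_mult_peak) auto
  with assms(2) have "peak r Z \<noteq> 0" by (intro notI) simp
  with peak_nonneg[of r Z] show ?thesis by simp
qed

section \<open>Splitting a cluster\<close>

text \<open>A normalized mass: replacing the peak by the mass of \<open>Z\<close> itself would give
  \<open>\<mu>(Z)\<^sup>1\<^sup>-\<^sup>1\<^sup>/\<^sup>t\<close>, the quantity that is to bound \<open>\<nu>\<close>. With the heaviest ball in the
  denominator it does not decrease in total when \<open>Z\<close> is split, and doubling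
  makes the two comparable.\<close>

definition potential :: "nat \<Rightarrow> real \<Rightarrow> 'a set \<Rightarrow> real" where
  "potential t r Z = prob Z / peak r Z powr (1 / real t)"

lemma potential_nonneg: "0 \<le> potential t r Z"
  unfolding potential_def by simp

text \<open>\<open>C\<close> is the cluster and \<open>D - C\<close> the shell around it that is discarded. The centre maximizes the
  mass of the ball of radius \<open>R/2\<close>, so the smallest ball \<open>B 0\<close> has mass \<open>peak (R/2) Z\<close>, while
  the largest one, \<open>B t\<close>, has mass at most \<open>M\<close>. Choosing \<open>C\<close> and \<open>D\<close> as the two balls of a step of small
  relative growth makes the potential of \<open>C\<close> at the halved radius pay for the mass of all of \<open>D\<close>.\<close>

lemma carve_cluster:
  assumes t: "t \<ge> 1" and R: "R > 0" and Z: "Z \<in> sets \<mu>" "prob Z > 0" and M: "peak R Z \<le> M"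
  obtains C D x where "C \<in> sets \<mu>" "D \<in> sets \<mu>" "C \<subseteq> D" "D \<subseteq> Z" "0 < prob C" "C \<subseteq> cball x R"
    "\<And>y z. y \<in> C \<Longrightarrow> z \<in> Z - D \<Longrightarrow> R / (2 * real t) < dist y z"
    "prob D / M powr (1 / real t) \<le> potential t (R / 2) C"
proof -
  obtain x where x: "x \<in> X" "prob (cball x (R/2) \<inter> Z) = peak (R/2) Z"
    using peak_attained[OF Z(1)] .
  define \<theta> where "\<theta> = R / (2 * real t)"
  have \<theta>: "\<theta> > 0" "real t * \<theta> = R / 2" using R t by (auto simp: \<theta>_def)
  define B where "B i = cball x (R/2 + real i * \<theta>) \<inter> Z" for i
  have B_sets: "B i \<in> sets \<mu>" for i unfolding B_def by (rule sets_cball_Int[OF Z(1)])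
  have B_mono: "B i \<subseteq> B j" if "i \<le> j" for i j
  proof -
    have "real i * \<theta> \<le> real j * \<theta>" using that \<theta> by (intro mult_right_mono) auto
    then show ?thesis by (auto simp: B_def)
  qed
  have B_prob: "prob (B i) \<le> prob (B j)" if "i \<le> j" for i j
    using finite_measure_mono[OF B_mono[OF that] B_sets] .
  have b0: "prob (B 0) = peak (R/2) Z" "prob (B 0) > 0"
    using x peak_pos[OF Z, of "R/2"] R by (auto simp: B_def)
  have bt: "prob (B t) > 0" "prob (B t) \<le> M"
    using b0(2) B_prob[of 0 t] order_trans[OF prob_le_peak[OF x(1)] M]
    by (auto simp: B_def \<theta>(2))
  obtain i where i: "i < t"
    "prob (B (Suc i)) / prob (B t) powr (1 / real t) \<le> prob (B i) / prob (B 0) powr (1 / real t)"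
    using exists_small_relative_growth[OF t, of "\<lambda>i. prob (B i)"] b0 bt by blast
  have pos: "prob (B i) > 0" using B_prob[of 0 i] b0 by simp
  \<comment> \<open>Within \<open>Z\<close>, hence within \<open>B i\<close>, no ball of radius \<open>R/2\<close> is heavier than \<open>B 0\<close>.\<close>
  have peak_le0: "peak (R/2) (B i) \<le> prob (B 0)"
    unfolding b0(1) by (rule peak_mono) (auto simp: B_def Z)
  have "prob (B (Suc i)) / M powr (1 / real t) \<le> prob (B (Suc i)) / prob (B t) powr (1 / real t)"
    using bt by (intro divide_left_mono powr_mono2 mult_pos_pos) auto
  also note i(2)
  also have "prob (B i) / prob (B 0) powr (1 / real t) \<le> potential t (R/2) (B i)"
    unfolding potential_def using peak_le0 peak_pos[OF B_sets pos, of "R/2"] R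
    by (intro divide_left_mono powr_mono2 mult_pos_pos) auto
  finally have pot: "prob (B (Suc i)) / M powr (1 / real t) \<le> potential t (R/2) (B i)" .
  show ?thesis
  proof (rule that[OF B_sets B_sets B_mono _ pos _ _ pot])
    show "B (Suc i) \<subseteq> Z" by (auto simp: B_def)
    have "real i * \<theta> \<le> real t * \<theta>" using i \<theta>(1) by (intro mult_right_mono) auto
    then have "real i * \<theta> \<le> R / 2" unfolding \<theta>(2) .
    then show "B i \<subseteq> cball x R" by (auto simp: B_def)
    fix y z assume "y \<in> B i" "z \<in> Z - B (Suc i)"
    then have "\<theta> < dist y z"
      using dist_triangle[of x z y] by (auto simp: B_def algebra_simps)
    then show "R / (2 * real t) < dist y z" by (simp add: \<theta>_def)
  qed simp
qed

text \<open>Carving is repeated on what is left of \<open>Z\<close>. The denominator is a common bound \<open>M\<close>, because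
  the peak of the remainder may have dropped and the masses should be added over a fixed denominator. Carving stops:
  in a finite net of mesh \<open>\<delta> = R/(4t)\<close>, a net ball that meets the new cluster \<open>C\<close> has
  diameter at most \<open>R/(2t)\<close> and so cannot reach the remainder \<open>Z - D\<close>.\<close>

lemma split_cluster_bounded:
  assumes t: "t \<ge> 1" and R: "R > 0" and Z: "Z \<in> sets \<mu>" and M: "peak R Z \<le> M"
  shows "\<exists>\<C>. finite \<C> \<and>
           (\<forall>C\<in>\<C>. C \<in> sets \<mu> \<and> C \<subseteq> Z \<and> 0 < prob C \<and> (\<exists>x. C \<subseteq> cball x R)) \<and>
           (\<forall>C\<in>\<C>. \<forall>C'\<in>\<C>. C \<noteq> C' \<longrightarrow> (\<forall>y\<in>C. \<forall>z\<in>C'. R / (2 * real t) \<le> dist y z)) \<and>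
           prob Z / M powr (1 / real t) \<le> (\<Sum>C\<in>\<C>. potential t (R / 2) C)"
proof -
  define \<delta> where "\<delta> = R / (4 * real t)"
  have \<delta>: "\<delta> > 0" "2 * \<delta> = R / (2 * real t)" using R t by (auto simp: \<delta>_def)
  obtain N where N: "finite N" "N \<subseteq> X" "X \<subseteq> (\<Union>x\<in>N. cball x \<delta>)" using finite_net[OF \<delta>(1)] .
  define touched where "touched Z = {p\<in>N. cball p \<delta> \<inter> Z \<noteq> {}}" for Z
  show ?thesis using Z M
  proof (induction "card (touched Z)" arbitrary: Z rule: less_induct)
    case less
    show ?case
    proof (cases "prob Z > 0")
      case False
      then have "prob Z = 0" using measure_nonneg[of \<mu> Z] by simp
      then show ?thesis by (intro exI[of _ "{}"]) auto
    next
      case True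
      obtain C D x where CD: "C \<in> sets \<mu>" "D \<in> sets \<mu>" "C \<subseteq> D" "D \<subseteq> Z" "0 < prob C" "C \<subseteq> cball x R"
        "\<And>y z. y \<in> C \<Longrightarrow> z \<in> Z - D \<Longrightarrow> R / (2 * real t) < dist y z"
        "prob D / M powr (1 / real t) \<le> potential t (R / 2) C"
        using carve_cluster[OF t R less.prems(1) True less.prems(2)] by blast
      obtain y where y: "y \<in> C" using CD(5) by fastforce
      then obtain p where p: "p \<in> N" "y \<in> cball p \<delta>" using N(3) CD(1) sets_iff by blast
      have "p \<notin> touched (Z - D)"
      proof
        assume "p \<in> touched (Z - D)"
        then obtain z where z: "z \<in> cball p \<delta>" "z \<in> Z - D"
          unfolding touched_def by blast
        then show False
          using CD(7)[OF y z(2)] dist_triangle[of y z p] p(2) \<delta>(2) by (auto simp: dist_commute)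
      qed
      moreover have "p \<in> touched Z" using y p CD(3,4) unfolding touched_def by blast
      moreover have "touched (Z - D) \<subseteq> touched Z" by (auto simp: touched_def)
      ultimately have fewer: "card (touched (Z - D)) < card (touched Z)"
        using N(1) by (intro psubset_card_mono) (auto simp: touched_def)
      have ZD: "Z - D \<in> sets \<mu>" using less.prems CD by auto
      have pk: "peak R (Z - D) \<le> M"
        using peak_mono[of "Z - D" Z R] less.prems by auto
      obtain \<C> where \<C>: "finite \<C>"
        "\<forall>C\<in>\<C>. C \<in> sets \<mu> \<and> C \<subseteq> Z - D \<and> 0 < prob C \<and> (\<exists>x. C \<subseteq> cball x R)"
        "\<forall>C\<in>\<C>. \<forall>C'\<in>\<C>. C \<noteq> C' \<longrightarrow> (\<forall>y\<in>C. \<forall>z\<in>C'. R / (2 * real t) \<le> dist y z)"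
        "prob (Z - D) / M powr (1 / real t) \<le> (\<Sum>C\<in>\<C>. potential t (R / 2) C)"
        using less.hyps[OF fewer ZD pk] by (elim exE conjE) (rule that; assumption)
      have "C \<notin> \<C>" using \<C>(2) y CD(3) by auto
      moreover have "prob Z = prob D + prob (Z - D)"
        using finite_measure_Diff[OF less.prems(1) CD(2,4)] by simp
      ultimately have mass: "prob Z / M powr (1 / real t) \<le> (\<Sum>C\<in>insert C \<C>. potential t (R / 2) C)"
        using \<C>(1,4) CD(8) by (simp add: add_divide_distrib)
      have far: "R / (2 * real t) \<le> dist y z" if "C' \<in> \<C>" "y \<in> C" "z \<in> C'" for C' y z
        using CD(7)[of y z] \<C>(2) that by fastforce
      have far': "R / (2 * real t) \<le> dist z y" if "C' \<in> \<C>" "y \<in> C" "z \<in> C'" for C' y z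
        using far[OF that] by (simp add: dist_commute)
      show ?thesis
      proof (intro exI[of _ "insert C \<C>"] conjI mass)
        show "finite (insert C \<C>)" using \<C>(1) by simp
        have "\<exists>x. C \<subseteq> cball x R" using CD(6) by blast
        moreover have "C \<subseteq> Z" using CD(3,4) by (rule subset_trans)
        ultimately show "\<forall>C\<in>insert C \<C>. C \<in> sets \<mu> \<and> C \<subseteq> Z \<and> 0 < prob C \<and> (\<exists>x. C \<subseteq> cball x R)"
          using \<C>(2) CD(1,5) by auto
        show "\<forall>A\<in>insert C \<C>. \<forall>A'\<in>insert C \<C>.
            A \<noteq> A' \<longrightarrow> (\<forall>y\<in>A. \<forall>z\<in>A'. R / (2 * real t) \<le> dist y z)"
          using \<C>(3) far far' by simp
      qed
    qed
  qed
qed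

lemma split_cluster:
  assumes "t \<ge> 1" "R > 0" "Z \<in> sets \<mu>"
  shows "\<exists>\<C>. finite \<C> \<and>
           (\<forall>C\<in>\<C>. C \<in> sets \<mu> \<and> C \<subseteq> Z \<and> 0 < prob C \<and> (\<exists>x. C \<subseteq> cball x R)) \<and>
           (\<forall>C\<in>\<C>. \<forall>C'\<in>\<C>. C \<noteq> C' \<longrightarrow> (\<forall>y\<in>C. \<forall>z\<in>C'. R / (2 * real t) \<le> dist y z)) \<and>
           potential t R Z \<le> (\<Sum>C\<in>\<C>. potential t (R / 2) C)"
  unfolding potential_def[of t R] using split_cluster_bounded[OF assms order_refl] .

section \<open>Potentials in doubling spaces\<close>

text \<open>Halving the diameter twice takes it from \<open>4r\<close> to \<open>r\<close>, at the cost of \<open>l\<^sup>2\<close> pieces, and a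
  piece of diameter at most \<open>r\<close> lies in the ball of radius \<open>r\<close> about any of its points.\<close>

lemma prob_le_doubling:
  assumes dbl: "doubling_space l X" and C: "C \<in> sets \<mu>" and diam: "\<And>x y. x \<in> C \<Longrightarrow> y \<in> C \<Longrightarrow> dist x y \<le> 4 * r"
    and r: "r \<ge> 0"
  shows "prob C \<le> real (l\<^sup>2) * peak r C"
proof -
  have CX: "C \<subseteq> X" using C sets_iff by auto
  have bd: "bounded C" using CX compact_imp_bounded[OF compact] bounded_subset by blast
  have dC: "diameter C \<le> 4 * r"
  proof (cases "C = {}")
    case False
    then show ?thesis using diam unfolding diameter_def by (auto intro!: cSUP_least)
  qed (use r in simp)
  define halves where "halves Z F \<longleftrightarrow> finite F \<and> card F \<le> l \<and> Z \<subseteq> \<Union>F \<and>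
      (\<forall>W\<in>F. W \<subseteq> X \<and> bounded W \<and> diameter W \<le> diameter Z / 2)" for Z F
  have "\<exists>F. halves Z F" if "Z \<subseteq> X" "bounded Z" for Z
    using dbl that unfolding doubling_space_def halves_def by simp
  then obtain G where halves: "\<And>Z. Z \<subseteq> X \<Longrightarrow> bounded Z \<Longrightarrow> halves Z (G Z)" by metis
  define F where "F = G C"
  have F: "finite F" "card F \<le> l" "C \<subseteq> \<Union>F"
    "\<forall>W\<in>F. W \<subseteq> X \<and> bounded W \<and> diameter W \<le> diameter C / 2"
    using halves[OF CX bd] unfolding halves_def F_def by simp_all
  have G: "finite (G W) \<and> card (G W) \<le> l \<and> W \<subseteq> \<Union>(G W) \<and>
      (\<forall>V\<in>G W. V \<subseteq> X \<and> bounded V \<and> diameter V \<le> diameter W / 2)" if "W \<in> F" for W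
    using halves[of W] F(4) that unfolding halves_def by simp
  define H where "H = (\<Union>W\<in>F. G W)"
  have finH: "finite H" using F(1) G by (auto simp: H_def)
  have "card H \<le> (\<Sum>W\<in>F. card (G W))" unfolding H_def using F(1) by (rule card_UN_le)
  also have "\<dots> \<le> card F * l" using sum_bounded_above[of F "\<lambda>W. card (G W)" l] G by simp
  also have "\<dots> \<le> l\<^sup>2" using F(2) by (simp add: power2_eq_square)
  finally have cardH: "card H \<le> l\<^sup>2" .
  have H: "V \<subseteq> X" "bounded V" "diameter V \<le> r" if V: "V \<in> H" for V
  proof -
    obtain W where W: "W \<in> F" "V \<in> G W" using V by (auto simp: H_def)
    show "V \<subseteq> X" "bounded V" using G W by auto
    have "diameter V \<le> diameter W / 2" "diameter W \<le> diameter C / 2" using G F(4) W by auto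
    then show "diameter V \<le> r" using dC by linarith
  qed
  \<comment> \<open>Empty pieces contain no centre and are dropped.\<close>
  define c where "c V = (SOME v. v \<in> V)" for V :: "'a set"
  define N where "N = c ` (H - {{}})"
  have c: "c V \<in> V" if "V \<noteq> {}" for V using that by (auto simp: c_def intro: someI_ex)
  have "C \<subseteq> (\<Union>x\<in>N. cball x r)"
  proof
    fix y assume "y \<in> C"
    then obtain W where "W \<in> F" "y \<in> W" using F(3) by blast
    then obtain V where V: "V \<in> H" "y \<in> V" using G[of W] unfolding H_def by blast
    then have "c V \<in> V" using c by auto
    then have "dist (c V) y \<le> diameter V" using V H(2) by (intro diameter_bounded_bound) auto
    then have "y \<in> cball (c V) r" using H(3)[OF V(1)] by simp
    then show "y \<in> (\<Union>x\<in>N. cball x r)" using V by (auto simp: N_def)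
  qed
  moreover have "N \<subseteq> X" using H(1) c by (auto simp: N_def)
  moreover have N: "finite N" using finH by (auto simp: N_def)
  ultimately have "prob C \<le> real (card N) * peak r C" using C by (intro prob_le_card_mult_peak) auto
  also have "card N \<le> l\<^sup>2"
    using card_image_le[of "H - {{}}" c] card_mono[of H "H - {{}}"] finH cardH by (auto simp: N_def)
  then have "real (card N) * peak r C \<le> real (l\<^sup>2) * peak r C"
    using peak_nonneg by (intro mult_right_mono) auto
  finally show ?thesis .
qed

lemma potential_le_doubling:
  assumes dbl: "doubling_space l X" and C: "C \<in> sets \<mu>" "prob C > 0"
    and diam: "\<And>x y. x \<in> C \<Longrightarrow> y \<in> C \<Longrightarrow> dist x y \<le> 4 * r" and r: "r > 0"
  shows "potential t r C \<le> real l powr (2 / real t) * prob C powr (1 - 1 / real t)"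
proof -
  have le: "prob C \<le> real (l\<^sup>2) * peak r C" using prob_le_doubling[OF dbl C(1) diam] r by simp
  then have l: "l > 0" using C(2) by (intro gr0I) simp
  have pk: "peak r C > 0" using peak_pos C r by simp
  have "prob C powr (1 / real t) \<le> (real (l\<^sup>2) * peak r C) powr (1 / real t)"
    using le C by (intro powr_mono2) auto
  also have "\<dots> = real l powr (2 / real t) * peak r C powr (1 / real t)"
    using l pk by (simp add: powr_mult powr_powr powr_realpow[symmetric] flip: powr_numeral)
  finally have "prob C powr (1 - 1 / real t) * prob C powr (1 / real t)
      \<le> prob C powr (1 - 1 / real t) * (real l powr (2 / real t) * peak r C powr (1 / real t))"
    by (intro mult_left_mono) auto
  then have "prob C \<le> real l powr (2 / real t) * prob C powr (1 - 1 / real t) * peak r C powr (1 / real t)"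
    using C(2) by (simp add: powr_add[symmetric] mult_ac)
  then show ?thesis using pk by (simp add: potential_def divide_le_eq)
qed

section \<open>The hierarchy of clusters\<close>

text \<open>One level of the hierarchy is encoded as the map from the unit interval that sends each point to
  the cluster owning it. The clusters are the values of the map on \<open>[0, 1)\<close>, and the mass given to a
  cluster is the length of its preimage, an interval.\<close>

definition cluster_level :: "nat \<Rightarrow> real \<Rightarrow> (real \<Rightarrow> 'a set) \<Rightarrow> bool" where
  "cluster_level t r G \<longleftrightarrow>
     finite (G ` {0..<1}) \<and>
     (\<forall>C\<in>G ` {0..<1}. C \<in> sets \<mu> \<and> 0 < prob C \<and> (\<forall>x\<in>C. \<forall>y\<in>C. dist x y \<le> 4 * r) \<and>
        (\<exists>a b. a \<le> b \<and> {s\<in>{0..<1}. G s = C} = {a..<b} \<and> b - a \<le> potential t r C)) \<and>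
     (\<forall>C\<in>G ` {0..<1}. \<forall>C'\<in>G ` {0..<1}.
        C \<noteq> C' \<longrightarrow> (\<forall>x\<in>C. \<forall>y\<in>C'. r / real t \<le> dist x y))"

lemma cluster_levelD:
  assumes "cluster_level t r G" and C: "C \<in> G ` {0..<1}"
  shows "C \<in> sets \<mu>" "0 < prob C" "\<And>x y. x \<in> C \<Longrightarrow> y \<in> C \<Longrightarrow> dist x y \<le> 4 * r"
    "\<exists>a b. a \<le> b \<and> {s\<in>{0..<1}. G s = C} = {a..<b} \<and> b - a \<le> potential t r C"
    "\<And>C' x y. C' \<in> G ` {0..<1} \<Longrightarrow> C \<noteq> C' \<Longrightarrow> x \<in> C \<Longrightarrow> y \<in> C' \<Longrightarrow> r / real t \<le> dist x y"
proof -
  note G = assms(1)[unfolded cluster_level_def, THEN conjunct2]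
  note 1 = bspec[OF G[THEN conjunct1] C]
  show "C \<in> sets \<mu>" "0 < prob C"
    "\<exists>a b. a \<le> b \<and> {s\<in>{0..<1}. G s = C} = {a..<b} \<and> b - a \<le> potential t r C"
    using 1 by simp_all
  show "dist x y \<le> 4 * r" if "x \<in> C" "y \<in> C" for x y using 1 that by simp
  show "r / real t \<le> dist x y" if "C' \<in> G ` {0..<1}" "C \<noteq> C'" "x \<in> C" "y \<in> C'" for C' x y
    using bspec[OF bspec[OF G[THEN conjunct2] C] that(1)] that(2-4) by simp
qed

lemma cluster_level_top:
  assumes R: "R > 0" and diam: "\<And>x y. x \<in> X \<Longrightarrow> y \<in> X \<Longrightarrow> dist x y \<le> R"
  shows "cluster_level t R (\<lambda>_. X)"
proof -
  have X: "X \<in> sets \<mu>" "prob X = 1" using sets.top[of \<mu>] prob_space space_eq by auto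
  have "0 < peak R X" using peak_pos X R by simp
  moreover have "peak R X \<le> 1" by (rule peak_le) simp
  ultimately have "peak R X powr (1 / real t) \<le> 1 powr (1 / real t)" by (intro powr_mono2) auto
  then have "1 \<le> potential t R X" using \<open>0 < peak R X\<close> X(2) by (simp add: potential_def)
  then have "\<exists>a b. a \<le> b \<and> {s\<in>{0..<1}. X = X} = {a..<b::real} \<and> b - a \<le> potential t R X"
    by (intro exI[of _ 0] exI[of _ 1]) auto
  moreover have "(\<lambda>_. X) ` {0..<1::real} = {X}" by (auto simp: image_constant_conv)
  moreover have "dist x y \<le> 4 * R" if "x \<in> X" "y \<in> X" for x y using diam[OF that] R by simp
  ultimately show ?thesis unfolding cluster_level_def using X by simp
qed

text \<open>Each cluster is split, and its interval is divided among its children. The interval is not longer than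
  the potential of the cluster and hence than the total potential of the children, so it can be used up
  without exceeding any of their potentials. Children of different clusters inherit the larger separation
  of their parents; in particular a child determines its parent, and its preimage is a single interval.\<close>

lemma cluster_level_refine:
  assumes t: "t \<ge> 1" and r: "r > 0" and G: "cluster_level t r G"
  shows "\<exists>G'. cluster_level t (r / 2) G' \<and> (\<forall>s\<in>{0..<1}. G' s \<subseteq> G s)"
proof -
  define child where "child \<C> h C \<longleftrightarrow> finite \<C> \<and>
      (\<forall>C'\<in>\<C>. C' \<in> sets \<mu> \<and> C' \<subseteq> C \<and> 0 < prob C' \<and> (\<exists>x. C' \<subseteq> cball x r)) \<and>
      (\<forall>A\<in>\<C>. \<forall>A'\<in>\<C>. A \<noteq> A' \<longrightarrow> (\<forall>y\<in>A. \<forall>z\<in>A'. r / (2 * real t) \<le> dist y z)) \<and>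
      (\<forall>s\<in>{0..<1}. G s = C \<longrightarrow> h s \<in> \<C>) \<and>
      (\<forall>C'\<in>\<C>. \<exists>c d. c \<le> d \<and> {s\<in>{0..<1}. G s = C \<and> h s = C'} = {c..<d} \<and>
          d - c \<le> potential t (r / 2) C')" for \<C> C and h :: "real \<Rightarrow> 'a set"
  have "\<exists>\<C> h. child \<C> h C" if C: "C \<in> G ` {0..<1}" for C
  proof -
    obtain a b where ab: "a \<le> b" "{s\<in>{0..<1}. G s = C} = {a..<b}" "b - a \<le> potential t r C"
      and Cs: "C \<in> sets \<mu>"
      using cluster_levelD(1,4)[OF G C] by blast
    from split_cluster[OF t r Cs] obtain \<C> where \<C>: "finite \<C>"
      "\<forall>C'\<in>\<C>. C' \<in> sets \<mu> \<and> C' \<subseteq> C \<and> 0 < prob C' \<and> (\<exists>x. C' \<subseteq> cball x r)"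
      "\<forall>A\<in>\<C>. \<forall>A'\<in>\<C>. A \<noteq> A' \<longrightarrow> (\<forall>y\<in>A. \<forall>z\<in>A'. r / (2 * real t) \<le> dist y z)"
      "potential t r C \<le> (\<Sum>C'\<in>\<C>. potential t (r / 2) C')"
      by (elim exE conjE) (rule that; assumption)
    have "b - a \<le> (\<Sum>C'\<in>\<C>. potential t (r / 2) C')" using ab(3) \<C>(4) by linarith
    from interval_allocation[OF \<C>(1) potential_nonneg ab(1) this] obtain h where h:
      "\<forall>s\<in>{a..<b}. h s \<in> \<C>"
      "\<forall>C'\<in>\<C>. \<exists>c d. c \<le> d \<and> {s\<in>{a..<b}. h s = C'} = {c..<d} \<and> d - c \<le> potential t (r / 2) C'"
      by (elim exE conjE) (rule that; assumption)
    have eq: "{s\<in>{0..<1}. G s = C \<and> h s = C'} = {s\<in>{a..<b}. h s = C'}" for C'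
      unfolding ab(2)[symmetric] by auto
    have "\<forall>s\<in>{0..<1}. G s = C \<longrightarrow> h s \<in> \<C>" using h(1) unfolding ab(2)[symmetric] by simp
    then have "child \<C> h C" unfolding child_def eq using \<C>(1,2,3) h(2) by simp
    then show ?thesis by blast
  qed
  then obtain \<C> h where ch: "\<And>C. C \<in> G ` {0..<1} \<Longrightarrow> child (\<C> C) (h C) C" by metis
  define G' where "G' s = h (G s) s" for s
  have G': "G' s \<in> \<C> (G s)" if "s \<in> {0..<1}" for s
    using ch[of "G s"] that unfolding child_def G'_def by simp
  have child_of: "C' \<in> sets \<mu> \<and> C' \<subseteq> C \<and> 0 < prob C' \<and> (\<exists>x. C' \<subseteq> cball x r)"
    if "C \<in> G ` {0..<1}" "C' \<in> \<C> C" for C C'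
    using bspec[OF ch[unfolded child_def, OF that(1), THEN conjunct2, THEN conjunct1] that(2)] .
  note siblings = ch[unfolded child_def, THEN conjunct2, THEN conjunct2, THEN conjunct1]
  have sub: "G' s \<subseteq> G s" if "s \<in> {0..<1}" for s using child_of G' that by blast
  have parents_sep: "r / real t \<le> dist y z"
    if "C \<in> G ` {0..<1}" "C' \<in> G ` {0..<1}" "C \<noteq> C'" "y \<in> C" "z \<in> C'" for C C' y z
    using cluster_levelD(5)[OF G] that by blast
  have rt: "0 < r / real t" using r t by simp
  have parent_unique: "C = D" if "C \<in> G ` {0..<1}" "D \<in> G ` {0..<1}" "A \<in> \<C> C" "A \<in> \<C> D" for A C D
  proof (rule ccontr)
    assume "C \<noteq> D"
    have "A \<noteq> {}" using child_of[OF that(1,3)] by auto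
    then obtain y where "y \<in> A" by auto
    then have "y \<in> C" "y \<in> D" using child_of that by blast+
    with parents_sep[OF that(1,2) \<open>C \<noteq> D\<close>, of y y] rt show False by simp
  qed
  have "cluster_level t (r / 2) G'"
    unfolding cluster_level_def
  proof (intro conjI ballI impI)
    have "G' ` {0..<1} \<subseteq> (\<Union>C\<in>G ` {0..<1}. \<C> C)" using G' by auto
    moreover have "finite (\<Union>C\<in>G ` {0..<1}. \<C> C)"
      using G ch by (intro finite_UN_I) (simp_all add: cluster_level_def child_def)
    ultimately show "finite (G' ` {0..<1})" by (rule finite_subset)
  next
    fix C' assume "C' \<in> G' ` {0..<1}"
    then obtain s where s: "s \<in> {0..<1}" "C' = G' s" by auto
    have *: "G s \<in> G ` {0..<1}" "C' \<in> \<C> (G s)" using s G' by auto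
    note c = child_of[OF *]
    show "C' \<in> sets \<mu>" "0 < prob C'" using c by auto
    have "{u\<in>{0..<1}. G' u = C'} = {u\<in>{0..<1}. G u = G s \<and> h (G s) u = C'}"
    proof (intro Collect_cong conj_cong refl iffI)
      fix u assume u: "u \<in> {0..<1::real}" "G' u = C'"
      then have "G u = G s" using parent_unique[of "G u" "G s" C'] G'[OF u(1)] * by simp
      then show "G u = G s \<and> h (G s) u = C'" using u by (auto simp: G'_def)
    qed (auto simp: G'_def)
    then show "\<exists>a b. a \<le> b \<and> {u\<in>{0..<1}. G' u = C'} = {a..<b} \<and> b - a \<le> potential t (r / 2) C'"
      using ch[OF *(1)] *(2) unfolding child_def by simp
    fix y z assume "y \<in> C'" "z \<in> C'"
    moreover obtain x where "C' \<subseteq> cball x r" using c by blast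
    ultimately have "dist x y \<le> r" "dist x z \<le> r" by auto
    then show "dist y z \<le> 4 * (r / 2)" using dist_triangle3[of y z x] by simp
  next
    fix A B y z assume A: "A \<in> G' ` {0..<1}" and B: "B \<in> G' ` {0..<1}" and "A \<noteq> B" "y \<in> A" "z \<in> B"
    from A obtain s where s: "s \<in> {0..<1}" "A = G' s" by auto
    from B obtain u where u: "u \<in> {0..<1}" "B = G' u" by auto
    show "r / 2 / real t \<le> dist y z"
    proof (cases "G s = G u")
      case True
      then have "A \<in> \<C> (G s)" "B \<in> \<C> (G s)" using G'[OF s(1)] G'[OF u(1)] s u by auto
      then have "r / (2 * real t) \<le> dist y z"
        using bspec[OF bspec[OF siblings[OF imageI[OF s(1)]]]] \<open>A \<noteq> B\<close> \<open>y \<in> A\<close> \<open>z \<in> B\<close> by simp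
      then show ?thesis by simp
    next
      case False
      have "r / real t \<le> dist y z"
        using parents_sep[OF _ _ False, of y z] sub s u \<open>y \<in> A\<close> \<open>z \<in> B\<close> by blast
      moreover have "r / 2 / real t = r / real t / 2" by simp
      ultimately show ?thesis using rt by linarith
    qed
  qed
  with sub show ?thesis by blast
qed

end

abbreviation unit_lebesgue :: "real measure" where
  "unit_lebesgue \<equiv> restrict_space lborel {0..<1}"

lemma prob_space_unit_lebesgue: "prob_space unit_lebesgue"
  by (rule prob_spaceI) (simp add: emeasure_restrict_space space_restrict_space)

lemma sets_unit_lebesgueI: "A \<in> sets borel \<Longrightarrow> A \<subseteq> {0..<1} \<Longrightarrow> A \<in> sets unit_lebesgue"
  by (simp add: sets_restrict_space_iff)

locale cluster_hierarchy = compact_prob_space X \<mu>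
  for X :: "'a::metric_space set" and \<mu> :: "'a measure" +
  fixes t :: nat and R :: real and G :: "nat \<Rightarrow> real \<Rightarrow> 'a set"
  assumes t: "t \<ge> 1" and R: "R > 0"
    and diam_X: "\<And>x y. x \<in> X \<Longrightarrow> y \<in> X \<Longrightarrow> dist x y \<le> R"
    and top: "G 0 = (\<lambda>_. X)"
    and level: "\<And>n. cluster_level t (R / 2 ^ n) (G n)"
    and nested: "\<And>n s. s \<in> {0..<1} \<Longrightarrow> G (Suc n) s \<subseteq> G n s"

lemma (in compact_prob_space) cluster_hierarchy_exists:
  assumes t: "t \<ge> 1"
  shows "\<exists>R G. cluster_hierarchy X \<mu> t R G"
proof -
  obtain e where e: "\<And>x y. x \<in> X \<Longrightarrow> y \<in> X \<Longrightarrow> dist x y \<le> e"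
    using compact_imp_bounded[OF compact] by (meson bounded_two_points)
  define R where "R = max 1 e"
  have R: "R > 0" and diam: "\<And>x y. x \<in> X \<Longrightarrow> y \<in> X \<Longrightarrow> dist x y \<le> R"
    using e by (auto simp: R_def le_max_iff_disj)
  have "\<exists>G. \<forall>n. (cluster_level t (R / 2 ^ n) (G n) \<and> (n = 0 \<longrightarrow> G n = (\<lambda>_. X))) \<and>
      (\<forall>s\<in>{0..<1}. G (Suc n) s \<subseteq> G n s)"
  proof (rule dependent_nat_choice)
    show "\<exists>H. cluster_level t (R / 2 ^ 0) H \<and> (0 = (0::nat) \<longrightarrow> H = (\<lambda>_. X))"
      using cluster_level_top[OF R diam] by auto
    fix H n assume "cluster_level t (R / 2 ^ n) H \<and> (n = 0 \<longrightarrow> H = (\<lambda>_. X))"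
    then show "\<exists>H'. (cluster_level t (R / 2 ^ Suc n) H' \<and> (Suc n = 0 \<longrightarrow> H' = (\<lambda>_. X))) \<and>
        (\<forall>s\<in>{0..<1}. H' s \<subseteq> H s)"
      using cluster_level_refine[OF t, of "R / 2 ^ n" H] R by (simp add: mult.commute)
  qed
  then obtain G where "\<And>n. cluster_level t (R / 2 ^ n) (G n)" "G 0 = (\<lambda>_. X)"
    "\<And>n s. s \<in> {0..<1} \<Longrightarrow> G (Suc n) s \<subseteq> G n s" by blast
  then have "cluster_hierarchy X \<mu> t R G"
    using t R diam by unfold_locales auto
  then show ?thesis by blast
qed

context cluster_hierarchy
begin

lemma cluster:
  assumes "s \<in> {0..<1}"
  shows "G n s \<in> sets \<mu>" "0 < prob (G n s)" "G n s \<noteq> {}" "G n s \<subseteq> X"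
    "\<And>x y. x \<in> G n s \<Longrightarrow> y \<in> G n s \<Longrightarrow> dist x y \<le> 4 * (R / 2 ^ n)"
    "\<exists>a b. a \<le> b \<and> {u\<in>{0..<1}. G n u = G n s} = {a..<b} \<and> b - a \<le> potential t (R / 2 ^ n) (G n s)"
proof -
  have s: "G n s \<in> G n ` {0..<1}" using assms by auto
  show "G n s \<in> sets \<mu>" "0 < prob (G n s)"
    "\<exists>a b. a \<le> b \<and> {u\<in>{0..<1}. G n u = G n s} = {a..<b} \<and> b - a \<le> potential t (R / 2 ^ n) (G n s)"
    "\<And>x y. x \<in> G n s \<Longrightarrow> y \<in> G n s \<Longrightarrow> dist x y \<le> 4 * (R / 2 ^ n)"
    using cluster_levelD[OF level s] by simp_all
  then show "G n s \<noteq> {}" "G n s \<subseteq> X" using sets_iff by auto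
qed

lemma nested_le: "s \<in> {0..<1} \<Longrightarrow> n \<le> m \<Longrightarrow> G m s \<subseteq> G n s"
  by (rule lift_Suc_antimono_le[of "\<lambda>n. G n s"]) (use nested in blast, assumption)

lemma finite_clusters: "finite (G n ` {0..<1})"
  using level[of n] unfolding cluster_level_def by blast

lemma dist_closure_clusters_ge:
  assumes "s \<in> {0..<1}" "u \<in> {0..<1}" "G n s \<noteq> G n u" "x \<in> closure (G n s)" "y \<in> closure (G n u)"
  shows "R / 2 ^ n / real t \<le> dist x y"
proof (rule dist_closure_ge[OF _ assms(4,5)])
  show "R / 2 ^ n / real t \<le> dist x y" if "x \<in> G n s" "y \<in> G n u" for x y
    using cluster_levelD(5)[OF level _ _ _ that] assms(1-3) by blast
qed

lemma dist_closure_cluster_le: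
  assumes "s \<in> {0..<1}" "x \<in> closure (G n s)" "y \<in> closure (G n s)"
  shows "dist x y \<le> 4 * (R / 2 ^ n)"
  by (rule dist_closure_le[OF cluster(5)[OF assms(1)] assms(2,3)])

lemma scale_tendsto_0: "(\<lambda>n. c * (R / 2 ^ n)) \<longlonglongrightarrow> 0"
proof -
  have "(\<lambda>n. c * R * (1 / 2) ^ n) \<longlonglongrightarrow> c * R * 0"
    by (intro tendsto_intros LIMSEQ_power_zero) simp
  then show ?thesis by (simp add: power_divide)
qed

text \<open>Pick a point from each cluster. Along the nested sequence of clusters owning \<open>s\<close> these points form a
  Cauchy sequence, whose limit lies in all closures. At each level there are
  finitely many clusters with intervals as preimages, so the limit map is measurable.\<close>

lemma limit_map_exists:
  "\<exists>g. g \<in> measurable unit_lebesgue (restrict_space borel X) \<and>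
       (\<forall>s\<in>{0..<1}. g s \<in> X \<and> (\<forall>n. g s \<in> closure (G n s)))"
proof -
  define c where "c C = (SOME x. x \<in> C)" for C :: "'a set"
  define f where "f n s = c (G n s)" for n s
  have f: "f n s \<in> G n s" if "s \<in> {0..<1}" for n s
    using cluster(3)[OF that] by (simp add: f_def c_def some_in_eq)
  have "\<exists>l\<in>X. (\<lambda>n. f n s) \<longlonglongrightarrow> l" if s: "s \<in> {0..<1}" for s
  proof -
    have "Cauchy (\<lambda>n. f n s)"
    proof (rule metric_CauchyI)
      fix e :: real assume "e > 0"
      then obtain n where n: "4 * (R / 2 ^ n) < e"
        using order_tendstoD(2)[OF scale_tendsto_0[of 4], of e] by (auto simp: eventually_sequentially)
      have "dist (f i s) (f j s) < e" if "n \<le> i" "n \<le> j" for i j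
        using cluster(5)[OF s, of "f i s" n "f j s"] f[OF s] nested_le[OF s] that n by fastforce
      then show "\<exists>M. \<forall>i\<ge>M. \<forall>j\<ge>M. dist (f i s) (f j s) < e" by blast
    qed
    moreover have "\<forall>n. f n s \<in> X" using f cluster(4) s by blast
    ultimately show ?thesis 
      using compact_imp_complete[OF compact, unfolded complete_def, THEN spec, of "\<lambda>n. f n s"] by simp
  qed
  then obtain g where g: "\<And>s. s \<in> {0..<1} \<Longrightarrow> g s \<in> X \<and> (\<lambda>n. f n s) \<longlonglongrightarrow> g s" by metis
  have "f n \<in> borel_measurable unit_lebesgue" for n
  proof -
    have "simple_function unit_lebesgue (G n)"
      unfolding simple_function_def
    proof (intro conjI ballI)
      show "finite (G n ` space unit_lebesgue)" using finite_clusters by (simp add: space_restrict_space)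
      fix C assume "C \<in> G n ` space unit_lebesgue"
      then obtain s where s: "s \<in> {0..<1}" "C = G n s" by (auto simp: space_restrict_space)
      obtain a b where ab: "{u\<in>{0..<1}. G n u = G n s} = {a..<b}" using cluster(6)[OF s(1)] by blast
      have "G n -` {C} \<inter> space unit_lebesgue = {u\<in>{0..<1}. G n u = G n s}"
        by (auto simp: space_restrict_space s)
      then have "G n -` {C} \<inter> space unit_lebesgue = {a..<b}" using ab by simp
      moreover have "{a..<b} \<subseteq> {0..<1}" unfolding ab[symmetric] by auto
      ultimately show "G n -` {C} \<inter> space unit_lebesgue \<in> sets unit_lebesgue"
        using sets_unit_lebesgueI[of "{a..<b}"] by simp
    qed
    then have "G n \<in> measurable unit_lebesgue (count_space UNIV)" by (rule measurable_simple_function)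
    then show ?thesis unfolding f_def by (rule measurable_compose) simp
  qed
  then have "g \<in> borel_measurable unit_lebesgue"
    by (rule borel_measurable_LIMSEQ_metric[where f = f]) (use g in \<open>auto simp: space_restrict_space\<close>)
  then have "g \<in> measurable unit_lebesgue (restrict_space borel X)"
    by (rule measurable_restrict_space2[rotated]) (use g in \<open>auto simp: space_restrict_space\<close>)
  moreover have "g s \<in> closure (G n s)" if s: "s \<in> {0..<1}" for s n
  proof (rule Lim_in_closed_set[where F = sequentially and f = "\<lambda>n. f n s"])
    show "eventually (\<lambda>m. f m s \<in> closure (G n s)) sequentially"
      using f[OF s] nested_le[OF s] closure_subset by (intro eventually_sequentiallyI[of n]) blast
  qed (use g[OF s] in auto)
  ultimately show ?thesis using g by blast
qed

text \<open>The closures of the finitely many clusters of one level cover the closure of the range of \<open>g\<close>, and they are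
  as far apart and as small as the clusters. Hence the levels induce a hierarchy of equivalence relations on
  this closure.\<close>

lemma ultrametric_distortion_limit_set:
  assumes g: "\<And>s n. s \<in> {0..<1} \<Longrightarrow> g s \<in> closure (G n s)"
  shows "ultrametric_distortion (closure (g ` {0..<1})) \<le> ereal (8 * real t)"
proof -
  let ?U = "closure (g ` {0..<1})"
  define E where "E n x y \<longleftrightarrow> (\<exists>s\<in>{0..<1}. x \<in> closure (G n s) \<and> y \<in> closure (G n s))" for n x y
  have cover: "\<exists>s\<in>{0..<1}. x \<in> closure (G n s)" if "x \<in> ?U" for x n
  proof -
    have "closed (\<Union>C\<in>G n ` {0..<1}. closure C)" using finite_clusters by (intro closed_UN) auto
    moreover have "g ` {0..<1} \<subseteq> (\<Union>C\<in>G n ` {0..<1}. closure C)" using g by blast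
    ultimately have "?U \<subseteq> (\<Union>C\<in>G n ` {0..<1}. closure C)" by (intro closure_minimal)
    then show ?thesis using that by blast
  qed
  have pos: "0 < R / 2 ^ n / real t" for n using R t by simp
  have same: "G n s = G n u" if "s \<in> {0..<1}" "u \<in> {0..<1}" "x \<in> closure (G n s)" "x \<in> closure (G n u)" for n s u x
    using dist_closure_clusters_ge[OF that(1,2) _ that(3,4)] pos[of n] by fastforce
  have "embeds_in_ultrametric ?U (8 * real t)"
  proof (rule embeds_in_ultrametric_of_hierarchy[where E = E and a = "\<lambda>n. 4 * (R / 2 ^ n)"
        and b = "\<lambda>n. R / 2 ^ n / real t"])
    show "E n x y \<Longrightarrow> E n y x" for n x y by (auto simp: E_def)
    show "E n x z \<Longrightarrow> E n z y \<Longrightarrow> E n x y" for n x y z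
      unfolding E_def using same by metis
    show "E 0 x y" if "x \<in> ?U" "y \<in> ?U" for x y
      using cover[OF that(1), of 0] cover[OF that(2), of 0] by (auto simp: E_def top)
    show "E (Suc n) x y \<Longrightarrow> E n x y" for n x y
      unfolding E_def using nested closure_mono by blast
    show "E n x y \<Longrightarrow> dist x y \<le> 4 * (R / 2 ^ n)" for n x y
      unfolding E_def using dist_closure_cluster_le by blast
    show "R / 2 ^ n / real t \<le> dist x y" if xy: "x \<in> ?U" "y \<in> ?U" and nE: "\<not> E n x y" for n x y
    proof -
      obtain s u where su: "s \<in> {0..<1}" "u \<in> {0..<1}" "x \<in> closure (G n s)" "y \<in> closure (G n u)"
        using cover xy by blast
      then have "G n s \<noteq> G n u" using nE unfolding E_def by metis
      with su show ?thesis by (intro dist_closure_clusters_ge)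
    qed
    show "decseq (\<lambda>n. 4 * (R / 2 ^ n))"
      using R by (intro decseq_SucI) (simp add: field_simps)
    show "(\<lambda>n. 4 * (R / 2 ^ n)) \<longlonglongrightarrow> 0" by (rule scale_tendsto_0)
    show "4 * (R / 2 ^ n) \<le> 8 * real t * (R / 2 ^ Suc n / real t)" for n
      using t by (simp add: field_simps)
  qed (use R in auto)
  then show ?thesis unfolding ultrametric_distortion_def using t by (intro Inf_lower) auto
qed

text \<open>The scale of the cluster containing the part of the skeleton in \<open>B(x, r)\<close> is the last one at
  which different clusters are more than \<open>2r\<close> apart.\<close>

lemma measure_preimage_cball_le:
  assumes dbl: "doubling_space l X"
    and g: "g \<in> measurable unit_lebesgue (restrict_space borel X)"
      "\<And>s n. s \<in> {0..<1} \<Longrightarrow> g s \<in> closure (G n s)"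
    and x: "x \<in> X" and r: "r > 0"
  shows "measure unit_lebesgue {s\<in>{0..<1}. g s \<in> cball x r} \<le>
    real l powr (2 / real t) * rpow (prob (cball x ((16 * real t + 1) * r) \<inter> X)) (1 - 1 / real t)"
proof -
  interpret L: prob_space unit_lebesgue by (rule prob_space_unit_lebesgue)
  let ?S = "{s\<in>{0..<1}. g s \<in> cball x r}"
  let ?B = "cball x ((16 * real t + 1) * r) \<inter> X"
  have X: "X \<in> sets \<mu>" "prob X = 1" using sets.top[of \<mu>] prob_space space_eq by auto
  have l: "1 \<le> real l powr (2 / real t)"
  proof -
    have "prob X \<le> real (l\<^sup>2) * peak R X"
      using diam_X R by (intro prob_le_doubling[OF dbl X(1)]) (force intro: order_trans[OF diam_X])+
    then have "l \<noteq> 0" using X(2) by (intro notI) simp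
    then show ?thesis by (intro ge_one_powr_ge_zero) auto
  qed
  show ?thesis
  proof (cases "R / real t \<le> 2 * r")
    case True
    \<comment> \<open>Not even the coarsest scale qualifies, as the enlarged ball is all of \<open>X\<close>.\<close>
    have "R \<le> 2 * real t * r" using True t by (simp add: field_simps)
    also have "\<dots> \<le> (16 * real t + 1) * r" using r by (intro mult_right_mono) auto
    finally have "dist x y \<le> (16 * real t + 1) * r" if "y \<in> X" for y
      using diam_X[OF x that] by linarith
    then have "?B = X" by auto
    then have "rpow (prob ?B) (1 - 1 / real t) = 1" using X by (simp add: rpow_def)
    then show ?thesis using l order_trans[OF L.prob_le_1] by simp
  next
    case False
    have "eventually (\<lambda>n. 1 / real t * (R / 2 ^ n) < 2 * r) sequentially"
      using order_tendstoD(2)[OF scale_tendsto_0[of "1 / real t"], of "2 * r"] r by simp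
    then have ex: "\<exists>n. R / 2 ^ n / real t \<le> 2 * r"
      by (auto simp: eventually_sequentially field_simps intro: less_imp_le)
    define n where "n = (LEAST n. R / 2 ^ n / real t \<le> 2 * r)"
    have n: "R / 2 ^ n / real t \<le> 2 * r" unfolding n_def using ex by (rule LeastI_ex)
    \<comment> \<open>The minimality of \<open>n\<close> makes \<open>r\<^sub>k > 2tr\<close>, while \<open>r\<^sub>k = 2r\<^sub>n \<le> 4tr\<close>.\<close>
    with False obtain k where k: "n = Suc k" by (cases n) auto
    have k1: "2 * r < R / 2 ^ k / real t"
      using not_less_Least[of k "\<lambda>n. R / 2 ^ n / real t \<le> 2 * r"] k by (simp add: n_def)
    have k2: "4 * (R / 2 ^ k) \<le> 16 * real t * r" using n t by (simp add: k field_simps)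
    show ?thesis
    proof (cases "?S = {}")
      case True
      show ?thesis unfolding True by (simp add: rpow_def)
    next
      case nonempty: False
      then obtain s where s: "s \<in> {0..<1}" "g s \<in> cball x r" by auto
      have "G k u = G k s" if u: "u \<in> ?S" for u
      proof (rule ccontr)
        assume "G k u \<noteq> G k s"
        then have "R / 2 ^ k / real t \<le> dist (g u) (g s)"
          using u s g(2) by (intro dist_closure_clusters_ge) auto
        moreover have "dist (g u) (g s) \<le> dist x (g u) + dist x (g s)" by (rule dist_triangle3)
        ultimately show False using k1 u s(2) by auto
      qed
      then have S: "?S \<subseteq> {u\<in>{0..<1}. G k u = G k s}" by auto
      obtain a b where ab: "a \<le> b" "{u\<in>{0..<1}. G k u = G k s} = {a..<b}"
        "b - a \<le> potential t (R / 2 ^ k) (G k s)" using cluster(6)[OF s(1)] by blast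
      have ab01: "{a..<b} \<subseteq> {0..<1}" unfolding ab(2)[symmetric] by auto
      have "measure unit_lebesgue ?S \<le> measure unit_lebesgue {a..<b}"
        using S unfolding ab(2)
        by (rule L.finite_measure_mono) (rule sets_unit_lebesgueI[OF _ ab01], simp)
      also have "\<dots> = b - a" using ab01 ab(1) by (simp add: measure_restrict_space)
      also note ab(3)
      also have "potential t (R / 2 ^ k) (G k s) \<le>
          real l powr (2 / real t) * prob (G k s) powr (1 - 1 / real t)"
        using R by (intro potential_le_doubling[OF dbl cluster(1,2,5)]) (use s in auto)
      also have "\<dots> \<le> real l powr (2 / real t) * prob ?B powr (1 - 1 / real t)"
      proof (intro mult_left_mono powr_mono2 finite_measure_mono)
        show "?B \<in> sets \<mu>" using sets_cball_Int X by blast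
        show "G k s \<subseteq> ?B"
        proof
          fix y assume y: "y \<in> G k s"
          then have "dist (g s) y \<le> 4 * (R / 2 ^ k)"
            using s g(2) closure_subset by (intro dist_closure_cluster_le[of s]) auto
          then have "dist x y \<le> r + 16 * real t * r"
            using dist_triangle[of x y "g s"] s(2) k2 by simp
          then show "y \<in> ?B" using y cluster(4)[OF s(1)] by (auto simp: algebra_simps)
        qed
      qed (use t in auto)
      also have "\<dots> \<le> real l powr (2 / real t) * rpow (prob ?B) (1 - 1 / real t)"
        by (intro mult_left_mono powr_le_rpow) auto
      finally show ?thesis .
    qed
  qed
qed

end

section \<open>Ultrametric skeletons\<close>

theorem theorem3:
  fixes X :: "'a::metric_space set" and \<mu> :: "'a measure" and l t :: nat
  assumes "compact X"
    and "doubling_space l X"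
    and "borel_prob_on X \<mu>"
    and "t \<ge> 1"
  shows "\<exists>U. closedin (top_of_set X) U \<and>
           ultrametric_distortion U \<le> ereal (8 * real t) \<and>
           (\<exists>\<nu>. borel_prob_on X \<nu> \<and> supported_on \<nu> U \<and>
             (\<forall>x\<in>X. \<forall>r\<ge>0.
                measure \<nu> (cball x r \<inter> X)
                  \<le> real l powr (2 / real t) *
                     rpow (measure \<mu> (cball x ((16 * real t + 1) * r) \<inter> X)) (1 - 1 / real t)))"
proof -
  interpret \<mu>: compact_prob_space X \<mu> using assms by unfold_locales
  obtain R G where "cluster_hierarchy X \<mu> t R G" using \<mu>.cluster_hierarchy_exists assms(4) by blast
  then interpret H: cluster_hierarchy X \<mu> t R G .
  obtain g where g: "g \<in> measurable unit_lebesgue (restrict_space borel X)"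
    "\<And>s. s \<in> {0..<1} \<Longrightarrow> g s \<in> X" "\<And>s n. s \<in> {0..<1} \<Longrightarrow> g s \<in> closure (G n s)"
    using H.limit_map_exists by blast
  interpret L: prob_space unit_lebesgue by (rule prob_space_unit_lebesgue)
  define U where "U = closure (g ` {0..<1})"
  define \<nu> where "\<nu> = distr unit_lebesgue (restrict_space borel X) g"
  have X: "closed X" using assms(1) by (rule compact_imp_closed)
  have U: "U \<subseteq> X" unfolding U_def using g(2) X by (intro closure_minimal) auto
  have "closedin (top_of_set X) U" using U by (intro closed_subset) (auto simp: U_def)
  moreover have "ultrametric_distortion U \<le> ereal (8 * real t)"
    unfolding U_def by (rule H.ultrametric_distortion_limit_set[OF g(3)])
  moreover have \<nu>: "borel_prob_on X \<nu>"
    using L.prob_space_distr[OF g(1)] by (simp add: borel_prob_on_def \<nu>_def)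
  moreover have "supported_on \<nu> U"
  proof -
    have "X - U \<in> sets (restrict_space borel X)"
      using X by (auto simp: sets_restrict_space_iff U_def)
    moreover have "g -` (X - U) \<inter> space unit_lebesgue = {}"
      using closure_subset[of "g ` {0..<1}"] by (auto simp: U_def space_restrict_space)
    ultimately show ?thesis
      using emeasure_distr[OF g(1), of "X - U"]
      by (simp add: supported_on_def \<nu>_def space_restrict_space)
  qed
  moreover have "measure \<nu> (cball x r \<inter> X) \<le> real l powr (2 / real t) *
      rpow (measure \<mu> (cball x ((16 * real t + 1) * r) \<inter> X)) (1 - 1 / real t)"
    if x: "x \<in> X" and "r \<ge> 0" for x r
  proof -
    interpret \<nu>: compact_prob_space X \<nu> using assms(1) \<nu> by unfold_locales
    define K where "K = 16 * real t + 1"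
    have K: "K > 0" by (simp add: K_def)
    have pos: "measure \<nu> (cball x r \<inter> X) \<le> real l powr (2 / real t) *
        rpow (measure \<mu> (cball x (K * r) \<inter> X)) (1 - 1 / real t)" if "r > 0" for r
    proof -
      have "measure \<nu> (cball x r \<inter> X) = measure unit_lebesgue (g -` (cball x r \<inter> X) \<inter> space unit_lebesgue)"
        unfolding \<nu>_def using X by (intro measure_distr[OF g(1)]) (auto simp: sets_restrict_space_iff)
      also have "g -` (cball x r \<inter> X) \<inter> space unit_lebesgue = {s\<in>{0..<1}. g s \<in> cball x r}"
        using g(2) by (auto simp: space_restrict_space)
      finally show ?thesis
        using H.measure_preimage_cball_le[OF assms(2) g(1,3) x that] by (simp add: K_def)
    qed
    have XS: "X \<in> sets \<mu>" "X \<in> sets \<nu>"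
      using sets.top[of \<mu>] \<mu>.space_eq sets.top[of \<nu>] \<nu>.space_eq by auto
    \<comment> \<open>No cluster scale corresponds to radius \<open>0\<close>; the bound is inherited from the radii \<open>1/(n+1)\<close>.\<close>
    have "measure \<nu> (cball x 0 \<inter> X) \<le> real l powr (2 / real t) *
        rpow (measure \<mu> (cball x (K * 0) \<inter> X)) (1 - 1 / real t)"
    proof (rule LIMSEQ_le)
      show "(\<lambda>n. measure \<nu> (cball x (0 + 1 / real (Suc n)) \<inter> X)) \<longlonglongrightarrow> measure \<nu> (cball x 0 \<inter> X)"
        by (rule \<nu>.tendsto_prob_cball) (use XS in auto)
      have lim: "(\<lambda>n. measure \<mu> (cball x (0 + K / real (Suc n)) \<inter> X)) \<longlonglongrightarrow> measure \<mu> (cball x (K * 0) \<inter> X)"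
        using \<mu>.tendsto_prob_cball[OF XS(1) K, of x 0] by simp
      have "(\<lambda>n. rpow (measure \<mu> (cball x (0 + K / real (Suc n)) \<inter> X)) (1 - 1 / real t))
          \<longlonglongrightarrow> rpow (measure \<mu> (cball x (K * 0) \<inter> X)) (1 - 1 / real t)"
      proof (cases "t = 1")
        \<comment> \<open>For \<open>t = 1\<close> the exponent is \<open>0\<close>, where \<open>rpow\<close> is constant; otherwise it is positive.\<close>
        case False
        then have "1 - 1 / real t > 0" using assms(4) by simp
        then show ?thesis unfolding rpow_def using lim by (auto intro!: tendsto_powr')
      qed (simp add: rpow_def)
      then show "(\<lambda>n. real l powr (2 / real t) * rpow (measure \<mu> (cball x (0 + K / real (Suc n)) \<inter> X)) (1 - 1 / real t))
          \<longlonglongrightarrow> real l powr (2 / real t) * rpow (measure \<mu> (cball x (K * 0) \<inter> X)) (1 - 1 / real t)"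
        by (intro tendsto_mult_left)
      show "\<exists>N. \<forall>n\<ge>N. measure \<nu> (cball x (0 + 1 / real (Suc n)) \<inter> X) \<le> real l powr (2 / real t) *
          rpow (measure \<mu> (cball x (0 + K / real (Suc n)) \<inter> X)) (1 - 1 / real t)"
        using pos[of "1 / real (Suc _)"] by simp
    qed
    with pos[of r] \<open>r \<ge> 0\<close> show ?thesis unfolding K_def by (cases "r = 0") auto
  qed
  ultimately show ?thesis by blast
qed

end
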